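(* Let $f:[0,1]\to[0,1]$ be countably Markov and mixing with transition matrix $M$. Then $(\Sigma_M,\sigma)$ and $([0,1],f)$ are isomorphic modulo countable invariant sets.
   Context: Countably Markov and mixing: a map $f:[0,1]\to[0,1]$ is called countably Markov and mixing if there is a countable partition $\mathcal X$ of $[0,1]$ such that: - $\mathcal X$ consists of open intervals $(a,b)$ and singletons $\{x\}$; write $\mathcal I$ for the set of open intervals belonging to $\mathcal X$ (partition intervals) and $C=\{x:\{x\}\in\mathcal X\}$ (partition points); - for each $i\in\mathcal I$ the restriction $f|_i$ is continuous and strictly monotone; - for each pair $i,j\in\mathcal I$ either $f(i)\supset j$ or $f(i)\cap j=\emptyset$; - $f(C)\subset C$; - $f$ is mixing: for each pair $U,V$ of nonempty open subsets of $[0,1]$ there is $N\ge0$ such that $f^n(U)\cap V\ne\emptyset$ for all $n\ge N$. ($f$ is not assumed continuous.) The transition matrix is $M=(m_{ij})_{i,j\in\mathcal I}$ with $m_{ij}=1$ if $f(i)\supset j$ and $m_{ij}=0$ if $f(i)\cap j=\emptyset$. $\Sigma_M=\{i_0i_1i_2\cdots\in\mathcal I^{\mathbb N_0}:m_{i_ni_{n+1}}=1\ \forall n\}$ is the one-sided Markov shift space with the topology generated by cylinder sets, and $\sigma$ is the left shift. A set $B$ is totally invariant for $f:X\to X$ if $f^{-1}(B)=B$. Two systems $(X_1,f_1)$, $(X_2,f_2)$ are isomorphic modulo countable invariant sets if there exist totally invariant countable sets $N_1\subset X_1$, $N_2\subset X_2$ and a bijection $\psi:X_1\setminus N_1\to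 X_2\setminus N_2$, bimeasurable with respect to the Borel $\sigma$-algebras, such that $f_2\circ\psi=\psi\circ f_1$. *)

theory Defs
  imports "HOL-Analysis.Analysis"
begin

section \<open>Countably Markov and mixing maps of the unit interval\<close>

definition partition_intervals :: "real set set \<Rightarrow> real set set" where
  "partition_intervals \<X> = {i \<in> \<X>. \<exists>a b. a < b \<and> i = {a<..<b}}"

definition partition_points :: "real set set \<Rightarrow> real set" where
  "partition_points \<X> = {x. {x} \<in> \<X>}"

definition topologically_mixing :: "'a topology \<Rightarrow> ('a \<Rightarrow> 'a) \<Rightarrow> bool" where
  "topologically_mixing T f \<longleftrightarrow>
     (\<forall>U V. openin T U \<and> U \<noteq> {} \<and> openin T V \<and> V \<noteq> {} \<longrightarrow>
        (\<exists>N. \<forall>n\<ge>N. (f ^^ n) ` U \<inter> V \<noteq> {}))"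

text \<open>
  The partition is an explicit argument, since the transition matrix depends on it.
  Maps of the unit interval are represented by functions on the reals of which only
  the values on the unit interval matter.
\<close>

definition countably_markov_mixing :: "(real \<Rightarrow> real) \<Rightarrow> real set set \<Rightarrow> bool" where
  "countably_markov_mixing f \<X> \<longleftrightarrow>
     f ` {0..1} \<subseteq> {0..1} \<and>
     countable \<X> \<and> partition_on {0..1} \<X> \<and>
     (\<forall>A\<in>\<X>. (\<exists>a b. a < b \<and> A = {a<..<b}) \<or> (\<exists>x. A = {x})) \<and>
     (\<forall>i\<in>partition_intervals \<X>.
        continuous_on i f \<and> (strict_mono_on i f \<or> strict_antimono_on i f)) \<and>
     (\<forall>i\<in>partition_intervals \<X>. \<forall>j\<in>partition_intervals \<X>.
        j \<subseteq> f ` i \<or> f ` i \<inter> j = {}) \<and>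
     f ` partition_points \<X> \<subseteq> partition_points \<X> \<and>
     topologically_mixing (top_of_set {0..1}) f"

definition transition_matrix :: "(real \<Rightarrow> real) \<Rightarrow> real set \<Rightarrow> real set \<Rightarrow> nat" where
  "transition_matrix f i j = (if j \<subseteq> f ` i then 1 else 0)"


section \<open>One-sided Markov shifts\<close>

definition markov_shift_space :: "'i set \<Rightarrow> ('i \<Rightarrow> 'i \<Rightarrow> nat) \<Rightarrow> (nat \<Rightarrow> 'i) set" where
  "markov_shift_space I M = {s. (\<forall>n. s n \<in> I) \<and> (\<forall>n. M (s n) (s (Suc n)) = 1)}"

definition cylinder :: "'i set \<Rightarrow> ('i \<Rightarrow> 'i \<Rightarrow> nat) \<Rightarrow> 'i list \<Rightarrow> (nat \<Rightarrow> 'i) set" where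
  "cylinder I M w = {s \<in> markov_shift_space I M. \<forall>k<length w. s k = w ! k}"

definition markov_shift :: "'i set \<Rightarrow> ('i \<Rightarrow> 'i \<Rightarrow> nat) \<Rightarrow> (nat \<Rightarrow> 'i) topology" where
  "markov_shift I M = topology_generated_by (cylinder I M ` lists I)"

definition left_shift :: "(nat \<Rightarrow> 'i) \<Rightarrow> (nat \<Rightarrow> 'i)" where
  "left_shift s = (\<lambda>n. s (Suc n))"

lemma topspace_markov_shift [simp]: "topspace (markov_shift I M) = markov_shift_space I M"
proof -
  have "cylinder I M [] = markov_shift_space I M"
    by (simp add: cylinder_def)
  then have "markov_shift_space I M \<in> cylinder I M ` lists I"
    by force
  moreover have "cylinder I M w \<subseteq> markov_shift_space I M" for w
    by (auto simp: cylinder_def)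
  ultimately show ?thesis
    unfolding markov_shift_def topology_generated_by_topspace by blast
qed


section \<open>Isomorphism modulo countable invariant sets\<close>

definition borel_of :: "'a topology \<Rightarrow> 'a measure" where
  "borel_of T = sigma (topspace T) {U. openin T U}"

definition totally_invariant :: "'a set \<Rightarrow> ('a \<Rightarrow> 'a) \<Rightarrow> 'a set \<Rightarrow> bool" where
  "totally_invariant X f B \<longleftrightarrow> B \<subseteq> X \<and> f -` B \<inter> X = B"

definition isomorphic_mod_countable ::
    "'a topology \<Rightarrow> ('a \<Rightarrow> 'a) \<Rightarrow> 'b topology \<Rightarrow> ('b \<Rightarrow> 'b) \<Rightarrow> bool" where
  "isomorphic_mod_countable T1 f1 T2 f2 \<longleftrightarrow>
     (\<exists>N1 N2 \<psi>.
        countable N1 \<and> totally_invariant (topspace T1) f1 N1 \<and>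
        countable N2 \<and> totally_invariant (topspace T2) f2 N2 \<and>
        bij_betw \<psi> (topspace T1 - N1) (topspace T2 - N2) \<and>
        \<psi> \<in> restrict_space (borel_of T1) (topspace T1 - N1)
              \<rightarrow>\<^sub>M restrict_space (borel_of T2) (topspace T2 - N2) \<and>
        inv_into (topspace T1 - N1) \<psi>
          \<in> restrict_space (borel_of T2) (topspace T2 - N2)
              \<rightarrow>\<^sub>M restrict_space (borel_of T1) (topspace T1 - N1) \<and>
        (\<forall>x\<in>topspace T1 - N1. f2 (\<psi> x) = \<psi> (f1 x)))"

end

theory Submission imports Defs begin

text \<open>
  A point of the unit interval whose orbit never meets a partition point has an itinerary: the
  sequence of partition intervals that its orbit visits. Only countably many points are lost in
  this way, because every branch of the map is injective, so that preimages of countable sets are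
  countable; and the lost set is totally invariant because the partition points are mapped to
  partition points. The itinerary map turns the dynamics into the shift, and it remains to see
  that it is injective, that it misses only countably many sequences, and that it is bimeasurable.

  All three rest on the cells, the sets of points whose orbits start with a prescribed finite word.
  Since the branches are continuous and strictly monotone, cells are relatively open intervals;
  by the Markov property, cells of words of the shift are nonempty. Along a sequence of the shift
  the cells shrink to one point (lemma \<open>cells_shrink\<close>). Otherwise an open interval would
  follow one and the same sequence of partition intervals, while by mixing its iterates must at
  some time meet any two given partition intervals at once. For this there have to be two partition
  intervals: a map with a single one would restrict to a strictly monotone self-map of the open
  unit interval, and the square of such a map is increasing and hence far from mixing.

  Shrinking of the cells gives injectivity. The sequence has a point precisely when the limit of
  its cells lies in all of them. If it does not, then it is an endpoint of one of the cells, and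
  all the cells of the sequence contain one-sided neighbourhoods of it, always on the same side. Two
  sequences with the same limit point and the same side have intersecting cells of every length,
  so they are equal. As there are only countably many cells, there are only countably many limit
  points of this kind, and so only countably many sequences without a point
  (lemma \<open>countable_empty_codes\<close>).

  Finally, the itinerary map exchanges cells with cylinders. Cylinders are a countable base of the
  shift space, and cells are arbitrarily small neighbourhoods of the points that have an itinerary.
  Hence the itinerary map and its inverse are both measurable.
\<close>

section \<open>Increasing maps are not mixing\<close>

text \<open>
  If some point moves, the open interval between it and its image is carried off monotonically and
  never returns; if no point moves, any two disjoint open sets will do.
\<close>

lemma increasing_not_mixing:
  fixes g :: "real \<Rightarrow> real"
  assumes mono: "strict_mono_on {0<..<1} g" and maps: "g ` {0<..<1} \<subseteq> {0<..<1}"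
  shows "\<exists>U V. open U \<and> U \<noteq> {} \<and> U \<subseteq> {0..1} \<and> open V \<and> V \<noteq> {} \<and> V \<subseteq> {0..1} \<and>
           (\<forall>n\<ge>1. (g ^^ n) ` U \<inter> V = {})"
proof -
  have iter: "(g ^^ n) x \<in> {0<..<1}" if "x \<in> {0<..<1}" for n x
  proof (induction n)
    case (Suc n)
    then show ?case using maps by (simp only: funpow.simps o_apply) blast
  qed (use that in simp)
  have iter_less: "(g ^^ n) x < (g ^^ n) y" if "x \<in> {0<..<1}" "y \<in> {0<..<1}" "x < y" for n x y
    using that(3)
  proof (induction n)
    case (Suc n)
    then show ?case
      using strict_mono_onD[OF mono iter[OF that(1)] iter[OF that(2)]] by simp
  qed simp
  show ?thesis
  proof (cases "\<exists>p\<in>{0<..<1}. g p \<noteq> p")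
    case False
    have "(g ^^ n) x = x" if "x \<in> {0<..<1}" for n x
      using that False by (induction n) auto
    then have "(g ^^ n) ` {0<..<1/2} \<inter> {1/2<..<1} = {}" for n
      by force
    moreover have "{0<..<1/2::real} \<noteq> {}" "{1/2<..<1::real} \<noteq> {}"
      by auto
    ultimately show ?thesis
      by (intro exI[of _ "{0<..<1/2}"] exI[of _ "{1/2<..<1}"]) auto
  next
    case True
    then obtain p where p: "p \<in> {0<..<1}" "g p \<noteq> p" by blast
    have gp: "g p \<in> {0<..<1}" using p(1) maps by blast
    define U where "U = {min p (g p)<..<max p (g p)}"
    have U: "open U" "U \<noteq> {}" "U \<subseteq> {0<..<1}"
      using p gp by (auto simp: U_def)
    have "(g ^^ n) x \<notin> U" if "n \<ge> 1" "x \<in> U" for n x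
    proof (cases "p < g p")
      case True
      have *: "g p \<le> (g ^^ k) (g p)" for k
      proof (induction k)
        case (Suc k)
        have "g p < g (g p)" using strict_mono_onD[OF mono p(1) gp True] .
        then have "(g ^^ k) (g p) < (g ^^ k) (g (g p))"
          using iter_less gp maps by blast
        with Suc show ?case by (simp add: funpow_swap1)
      qed simp
      have "(g ^^ n) p < (g ^^ n) x"
        using iter_less[OF p(1)] that(2) U(3) True by (auto simp: U_def)
      moreover have "g p \<le> (g ^^ n) p"
        using *[of "n - 1"] that(1) by (cases n) (auto simp: funpow_swap1)
      ultimately show ?thesis using True by (auto simp: U_def)
    next
      case False
      then have lt: "g p < p" using p(2) by simp
      have *: "(g ^^ k) (g p) \<le> g p" for k
      proof (induction k)
        case (Suc k)
        have "g (g p) < g p" using strict_mono_onD[OF mono gp p(1) lt] .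
        then have "(g ^^ k) (g (g p)) < (g ^^ k) (g p)"
          using iter_less gp maps by blast
        with Suc show ?case by (simp add: funpow_swap1)
      qed simp
      have "(g ^^ n) x < (g ^^ n) p"
        using iter_less[OF _ p(1)] that(2) U(3) lt by (auto simp: U_def)
      moreover have "(g ^^ n) p \<le> g p"
        using *[of "n - 1"] that(1) by (cases n) (auto simp: funpow_swap1)
      ultimately show ?thesis using lt by (auto simp: U_def)
    qed
    then have "\<forall>n\<ge>1. (g ^^ n) ` U \<inter> U = {}" by blast
    moreover have "U \<subseteq> {0..1}"
      using U(3) by (rule order_trans) auto
    ultimately show ?thesis using U(1,2) by (intro exI[of _ U]) simp
  qed
qed

section \<open>Intervals, cylinders and measurability\<close>

text \<open>
  Applied below to a point that is a limit of shrinking cells without belonging to them: the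
  alternative provides both the countable set in which the point lies and the filter that
  determines the cells.
\<close>

lemma interval_one_sided_neighbourhood:
  fixes S :: "real set"
  assumes S: "is_interval S" "S \<noteq> {}" "bdd_below S" "bdd_above S"
    and z: "Inf S \<le> z" "z \<le> Sup S" "z \<notin> S"
  shows "z = Inf S \<and> (\<forall>\<^sub>F x in at_right z. x \<in> S) \<or> z = Sup S \<and> (\<forall>\<^sub>F x in at_left z. x \<in> S)"
proof -
  obtain y where y: "y \<in> S" using S(2) by blast
  then consider "z < y" | "y < z" using z(3) by fastforce
  then show ?thesis
  proof cases
    case 1
    have above: "z < x" if "x \<in> S" for x
    proof (rule ccontr)
      assume "\<not> z < x"
      then have "x \<le> z" "z \<le> y" using 1 by auto
      with S(1) that y have "z \<in> S" unfolding is_interval_1 by blast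
      with z(3) show False ..
    qed
    have eq: "z = Inf S"
      by (intro antisym z(1) cInf_greatest[OF S(2)]) (use above in fastforce)
    have "x \<in> S" if x: "z < x" "x < y" for x
    proof -
      obtain t where "t \<in> S" "t < x" using cInf_lessD[OF S(2)] x(1) eq by blast
      then show ?thesis using S(1) y x(2) unfolding is_interval_1 by (meson less_imp_le)
    qed
    then have "\<forall>\<^sub>F x in at_right z. x \<in> S"
      using 1 by (auto simp: eventually_at_right)
    with eq show ?thesis by blast
  next
    case 2
    have below: "x < z" if "x \<in> S" for x
    proof (rule ccontr)
      assume "\<not> x < z"
      then have "y \<le> z" "z \<le> x" using 2 by auto
      with S(1) that y have "z \<in> S" unfolding is_interval_1 by blast
      with z(3) show False ..
    qed
    have eq: "z = Sup S"
      by (intro antisym z(2) cSup_least[OF S(2)]) (use below in fastforce)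
    have "x \<in> S" if x: "y < x" "x < z" for x
    proof -
      obtain t where "t \<in> S" "x < t" using less_cSupD[OF S(2)] x(2) eq by blast
      then show ?thesis using S(1) y x(1) unfolding is_interval_1 by (meson less_imp_le)
    qed
    then have "\<forall>\<^sub>F x in at_left z. x \<in> S"
      using 2 by (auto simp: eventually_at_left)
    with eq show ?thesis by blast
  qed
qed

text \<open>
  The preimage of an open set is a countable union of the open sets \<open>A w\<close>, cut down to the domain.
  Both the itinerary map, with cells, and its inverse, with cylinders, fall under this criterion.
\<close>

lemma measurable_of_countable_neighbourhoods:
  assumes "countable W" and D: "D \<subseteq> topspace T" and D': "D' \<subseteq> topspace T'"
    and h: "h \<in> D \<rightarrow> D'"
    and A: "\<And>w. w \<in> W \<Longrightarrow> openin T (A w)"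
    and nbhd: "\<And>U x. openin T' U \<Longrightarrow> x \<in> D \<Longrightarrow> h x \<in> U \<Longrightarrow> \<exists>w\<in>W. x \<in> A w \<and> h ` (A w \<inter> D) \<subseteq> U"
  shows "h \<in> restrict_space (borel_of T) D \<rightarrow>\<^sub>M restrict_space (borel_of T') D'"
proof -
  have opens: "{U. openin S U} \<subseteq> Pow (topspace S)" for S :: "'z topology"
    using openin_subset by blast
  have spaceD: "space (restrict_space (borel_of T) D) = D"
    using D opens[of T] by (auto simp: space_restrict_space borel_of_def)
  have "h \<in> restrict_space (borel_of T) D \<rightarrow>\<^sub>M borel_of T'"
    unfolding borel_of_def[of T']
  proof (rule measurable_measure_of)
    show "{U. openin T' U} \<subseteq> Pow (topspace T')"
      using openin_subset by blast
    show "h \<in> space (restrict_space (borel_of T) D) \<rightarrow> topspace T'"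
      using h D' spaceD by auto
    fix U assume "U \<in> {U. openin T' U}"
    then have U: "openin T' U" by simp
    define W' where "W' = {w \<in> W. h ` (A w \<inter> D) \<subseteq> U}"
    have preimage: "h -` U \<inter> D = (\<Union>w\<in>W'. D \<inter> A w)"
      using nbhd[OF U] unfolding W'_def by blast
    have "D \<inter> A w \<in> sets (restrict_space (borel_of T) D)" if "w \<in> W'" for w
    proof -
      have "A w \<in> sets (borel_of T)"
        using A that opens[of T] unfolding W'_def borel_of_def by auto
      then show ?thesis by (auto simp: sets_restrict_space)
    qed
    moreover have "countable W'"
      using \<open>countable W\<close> unfolding W'_def by simp
    ultimately show "h -` U \<inter> space (restrict_space (borel_of T) D)
        \<in> sets (restrict_space (borel_of T) D)"
      unfolding spaceD preimage by (intro sets.countable_UN') blast+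
  qed
  then show ?thesis
    using h spaceD by (intro measurable_restrict_space2) auto
qed

text \<open>
  The generating family of cylinders is a base: two cylinders along the same sequence
  are nested, so finite intersections produce nothing new.
\<close>

lemma openin_markov_shift_cylinder:
  assumes "openin (markov_shift I M) U" "s \<in> U"
  shows "\<exists>n. cylinder I M (map s [0..<n]) \<subseteq> U"
proof -
  have "generate_topology_on (cylinder I M ` lists I) U"
    using assms(1) by (simp add: markov_shift_def openin_topology_generated_by_iff)
  then show ?thesis
    using assms(2)
  proof (induction rule: generate_topology_on.induct)
    case Empty
    then show ?case by simp
  next
    case (Int U V)
    then obtain m n where mn: "cylinder I M (map s [0..<m]) \<subseteq> U" "cylinder I M (map s [0..<n]) \<subseteq> V"
      by blast
    have "cylinder I M (map s [0..<max m n]) \<subseteq> cylinder I M (map s [0..<m]) \<inter> cylinder I M (map s [0..<n])"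
      by (auto simp: cylinder_def)
    with mn show ?case by blast
  next
    case (UN K)
    then show ?case by blast
  next
    case (Basis U)
    then obtain w where w: "U = cylinder I M w" by blast
    then have "cylinder I M (map s [0..<length w]) \<subseteq> U"
      using Basis by (auto simp: cylinder_def)
    then show ?case by blast
  qed
qed

section \<open>The partition\<close>

locale countably_markov_mixing_map =
  fixes f :: "real \<Rightarrow> real" and \<X> :: "real set set"
  assumes markov: "countably_markov_mixing f \<X>"
begin

abbreviation "\<I> \<equiv> partition_intervals \<X>"
abbreviation "C \<equiv> partition_points \<X>"
abbreviation "shift_space \<equiv> markov_shift_space \<I> (transition_matrix f)"

lemma
  shows maps_image: "f ` {0..1} \<subseteq> {0..1}"
    and countable_partition: "countable \<X>"
    and partition: "partition_on {0..1} \<X>"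
    and partition_shape: "\<forall>A\<in>\<X>. (\<exists>a b. a < b \<and> A = {a<..<b}) \<or> (\<exists>x. A = {x})"
    and branches: "\<forall>i\<in>\<I>. continuous_on i f \<and> (strict_mono_on i f \<or> strict_antimono_on i f)"
    and markov_property: "\<forall>i\<in>\<I>. \<forall>j\<in>\<I>. j \<subseteq> f ` i \<or> f ` i \<inter> j = {}"
    and points_image: "f ` C \<subseteq> C"
    and topologically_mixing: "topologically_mixing (top_of_set {0..1}) f"
  using markov unfolding countably_markov_mixing_def by simp_all

lemma maps_unit_interval: "x \<in> {0..1} \<Longrightarrow> f x \<in> {0..1}"
  using maps_image by blast

lemma funpow_unit_interval: "x \<in> {0..1} \<Longrightarrow> (f ^^ n) x \<in> {0..1}"
  by (induction n) (use maps_unit_interval in auto)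

lemma partition_interval:
  assumes "i \<in> \<I>"
  shows "i \<subseteq> {0..1}" "open i" "is_interval i" "i \<noteq> {}"
proof -
  have "i \<in> \<X>" using assms by (simp add: partition_intervals_def)
  then show "i \<subseteq> {0..1}" using partition_onD1[OF partition] by blast
  obtain a b where "a < b" "i = {a<..<b}"
    using assms by (auto simp: partition_intervals_def)
  then show "open i" "is_interval i" "i \<noteq> {}"
    by (simp_all add: is_interval_oo)
qed

lemma partition_class_unique: "A \<in> \<X> \<Longrightarrow> B \<in> \<X> \<Longrightarrow> x \<in> A \<Longrightarrow> x \<in> B \<Longrightarrow> A = B"
  using partition_onD2[OF partition] disjointD by blast

lemma partition_interval_unique: "i \<in> \<I> \<Longrightarrow> j \<in> \<I> \<Longrightarrow> x \<in> i \<Longrightarrow> x \<in> j \<Longrightarrow> i = j"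
  by (rule partition_class_unique) (auto simp: partition_intervals_def)

lemma partition_interval_no_point:
  assumes "i \<in> \<I>" "x \<in> i"
  shows "x \<notin> C"
proof
  assume "x \<in> C"
  then have "{x} \<in> \<X>" by (simp add: partition_points_def)
  moreover have "i \<in> \<X>" using assms by (simp add: partition_intervals_def)
  ultimately have "i = {x}"
    using assms(2) by (intro partition_class_unique) auto
  then show False
    using partition_interval(2)[OF assms(1)] not_open_singleton by blast
qed

lemma partition_interval_cover:
  assumes "x \<in> {0..1}" "x \<notin> C"
  shows "\<exists>i\<in>\<I>. x \<in> i"
proof -
  obtain A where A: "A \<in> \<X>" "x \<in> A"
    using assms(1) partition_onD1[OF partition] by blast
  then have "A \<noteq> {y}" for y
    using assms(2) by (auto simp: partition_points_def)
  then have "A \<in> \<I>"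
    using A(1) partition_shape unfolding partition_intervals_def by (metis (mono_tags, lifting) mem_Collect_eq)
  with A(2) show ?thesis ..
qed

lemma countable_intervals: "countable \<I>"
  using countable_partition unfolding partition_intervals_def by simp

lemma countable_points: "countable C"
proof (rule countable_image_inj_on)
  show "countable ((\<lambda>x. {x}) ` C)"
    by (rule countable_subset[OF _ countable_partition]) (auto simp: partition_points_def)
qed simp

lemma points_invariant: "x \<in> C \<Longrightarrow> f x \<in> C"
  using points_image by blast

lemma branch_continuous: "i \<in> \<I> \<Longrightarrow> continuous_on i f"
  using branches by blast

lemma branch_monotone: "i \<in> \<I> \<Longrightarrow> strict_mono_on i f \<or> strict_antimono_on i f"
  using branches by blast

lemma branch_inj: "i \<in> \<I> \<Longrightarrow> inj_on f i"
  using branch_monotone[of i]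
  by (auto intro!: linorder_inj_onI' dest: strict_mono_onD monotone_onD)

text \<open>
  By the Markov property an image of a branch that meets a partition interval contains it; this is
  what makes itineraries admissible sequences.
\<close>

lemma transition_iff: "i \<in> \<I> \<Longrightarrow> j \<in> \<I> \<Longrightarrow> transition_matrix f i j = 1 \<longleftrightarrow> f ` i \<inter> j \<noteq> {}"
  using markov_property partition_interval(4)[of j]
  unfolding transition_matrix_def by auto

lemma mixing:
  assumes "open U" "U \<noteq> {}" "U \<subseteq> {0..1}" "open V" "V \<noteq> {}" "V \<subseteq> {0..1}"
  shows "\<exists>N. \<forall>n\<ge>N. (f ^^ n) ` U \<inter> V \<noteq> {}"
proof -
  have "openin (top_of_set {0..1}) U" "openin (top_of_set {0..1}) V"
    using assms by (simp_all add: open_subset)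
  with assms show ?thesis
    using topologically_mixing unfolding topologically_mixing_def by blast
qed

lemma exists_interval: "\<I> \<noteq> {}"
proof
  assume "\<I> = {}"
  then have "{0..1} \<subseteq> C" using partition_interval_cover by blast
  then have "countable {0..1::real}" using countable_points countable_subset by blast
  then show False using uncountable_closed_interval[of 0 "1::real"] by simp
qed

section \<open>Mixing forbids an interval with a common itinerary\<close>

text \<open>
  The complement of a single partition interval consists of partition points, hence is countable
  and contains no interval.
\<close>

lemma single_interval:
  assumes "\<I> = {i}"
  shows "i = {0<..<1}"
proof -
  obtain a b where ab: "a < b" "i = {a<..<b}"
    using assms unfolding partition_intervals_def by blast
  have "{a<..<b} \<subseteq> {0..1}" using partition_interval(1)[of i] assms ab by auto
  then have "0 \<le> a" "b \<le> 1"
    using ab(1) greaterThanLessThan_subseteq_atLeastAtMost_iff by blast+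
  have rest: "countable ({0..1} - i)"
    by (rule countable_subset[OF _ countable_points]) (use partition_interval_cover assms in blast)
  have "a \<le> 0"
  proof (rule ccontr)
    assume "\<not> a \<le> 0"
    then have "uncountable {0<..<a}" using uncountable_open_interval by simp
    moreover have "{0<..<a} \<subseteq> {0..1} - i" using ab \<open>b \<le> 1\<close> by auto
    ultimately show False using rest countable_subset by blast
  qed
  moreover have "1 \<le> b"
  proof (rule ccontr)
    assume "\<not> 1 \<le> b"
    then have "uncountable {b<..<1}" using uncountable_open_interval by simp
    moreover have "{b<..<1} \<subseteq> {0..1} - i" using ab \<open>0 \<le> a\<close> by auto
    ultimately show False using rest countable_subset by blast
  qed
  ultimately show ?thesis using ab \<open>0 \<le> a\<close> \<open>b \<le> 1\<close> by auto
qed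

text \<open>
  With one partition interval, the map restricts to a strictly monotone self-map of the open unit
  interval. It may be decreasing, but its square is increasing, and the failure of mixing for the
  square passes to the map.
\<close>

lemma two_intervals: "\<exists>i\<in>\<I>. \<exists>j\<in>\<I>. i \<noteq> j"
proof (rule ccontr)
  assume "\<not> ?thesis"
  then obtain i where i: "\<I> = {i}" using exists_interval by blast
  note i01 = single_interval[OF i]
  have mono: "strict_mono_on {0<..<1} f \<or> strict_antimono_on {0<..<1} f"
    using branch_monotone[of i] i i01 by simp
  \<comment> \<open>An interior point lies between two others, so strict monotonicity keeps its image off 0 and 1.\<close>
  have inner: "f x \<in> {0<..<1}" if x: "x \<in> {0<..<1}" for x
  proof -
    let ?y = "x / 2" and ?z = "(x + 1) / 2"
    have "?y \<in> {0<..<1}" "?z \<in> {0<..<1}" "?y < x" "x < ?z" using x by auto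
    then have "f ?y < f x \<and> f x < f ?z \<or> f ?z < f x \<and> f x < f ?y"
      using mono x by (meson strict_mono_onD monotone_onD)
    moreover have "f ?y \<in> {0..1}" "f ?z \<in> {0..1}"
      using x by (intro maps_unit_interval; simp)+
    ultimately show ?thesis by auto
  qed
  have "strict_mono_on {0<..<1} (f ^^ 2)"
  proof (rule strict_mono_onI)
    fix x y :: real assume xy: "x \<in> {0<..<1}" "y \<in> {0<..<1}" "x < y"
    show "(f ^^ 2) x < (f ^^ 2) y"
      using mono
    proof
      assume m: "strict_mono_on {0<..<1} f"
      show ?thesis
        using strict_mono_onD[OF m inner[OF xy(1)] inner[OF xy(2)] strict_mono_onD[OF m xy]]
        by (simp add: numeral_2_eq_2)
    next
      assume m: "strict_antimono_on {0<..<1} f"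
      show ?thesis
        using monotone_onD[OF m inner[OF xy(2)] inner[OF xy(1)]] monotone_onD[OF m xy]
        by (simp add: numeral_2_eq_2)
    qed
  qed
  moreover have "(f ^^ 2) ` {0<..<1} \<subseteq> {0<..<1}"
    using inner by (auto simp: numeral_2_eq_2)
  ultimately obtain U V where UV: "open U" "U \<noteq> {}" "U \<subseteq> {0..1}" "open V" "V \<noteq> {}" "V \<subseteq> {0..1}"
    and disj: "\<And>n. n \<ge> 1 \<Longrightarrow> ((f ^^ 2) ^^ n) ` U \<inter> V = {}"
    using increasing_not_mixing by meson
  obtain N where N: "\<And>n. n \<ge> N \<Longrightarrow> (f ^^ n) ` U \<inter> V \<noteq> {}"
    using mixing[OF UV] by blast
  have "(f ^^ (2 * Suc N)) ` U \<inter> V \<noteq> {}" by (rule N) simp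
  moreover have "((f ^^ 2) ^^ Suc N) ` U \<inter> V = {}" by (rule disj) simp
  ultimately show False by (simp only: funpow_mult mult.commute)
qed

text \<open>
  By mixing, the iterates of the interval eventually meet each of two distinct partition intervals,
  so from some time on the partition interval visited would equal both.
\<close>

lemma no_interval_with_constant_itinerary:
  assumes "a < b" "{a<..<b} \<subseteq> {0..1}" "\<And>n. s n \<in> \<I>"
    and all: "\<And>x n. x \<in> {a<..<b} \<Longrightarrow> (f ^^ n) x \<in> s n"
  shows False
proof -
  obtain i j where ij: "i \<in> \<I>" "j \<in> \<I>" "i \<noteq> j" using two_intervals by blast
  have eventually: "\<exists>N. \<forall>n\<ge>N. s n = k" if k: "k \<in> \<I>" for k
  proof -
    obtain N where N: "\<forall>n\<ge>N. (f ^^ n) ` {a<..<b} \<inter> k \<noteq> {}"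
      using mixing[of "{a<..<b}" k] assms(1,2) partition_interval[OF k] by auto
    have "s n = k" if "n \<ge> N" for n
    proof -
      have "(f ^^ n) ` {a<..<b} \<inter> k \<noteq> {}" using N that by simp
      then obtain x where "x \<in> {a<..<b}" "(f ^^ n) x \<in> k"
        by (simp only: disjoint_iff image_iff) metis
      with all[of x n] show ?thesis by (intro partition_interval_unique[OF assms(3) k])
    qed
    then show ?thesis by blast
  qed
  obtain m n where "\<forall>l\<ge>m. s l = i" "\<forall>l\<ge>n. s l = j"
    using eventually ij(1,2) by meson
  then have "s (max m n) = i" "s (max m n) = j" by (meson max.cobounded1 max.cobounded2)+
  with ij(3) show False by simp
qed

section \<open>Cells\<close>

definition word_cell :: "real set list \<Rightarrow> real set" where
  "word_cell w = {x \<in> {0..1}. \<forall>k<length w. (f ^^ k) x \<in> w ! k}"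

abbreviation cell :: "(nat \<Rightarrow> real set) \<Rightarrow> nat \<Rightarrow> real set" where
  "cell s n \<equiv> word_cell (map s [0..<n])"

lemma cell_iff: "x \<in> cell s n \<longleftrightarrow> x \<in> {0..1} \<and> (\<forall>k<n. (f ^^ k) x \<in> s k)"
  by (auto simp: word_cell_def)

lemma cell_antimono: "m \<le> n \<Longrightarrow> cell s n \<subseteq> cell s m"
  by (auto simp: cell_iff)

lemma word_cell_Nil [simp]: "word_cell [] = {0..1}"
  by (auto simp: word_cell_def)

lemma word_cell_Cons:
  assumes "i \<in> \<I>"
  shows "word_cell (i # w) = {x \<in> i. f x \<in> word_cell w}"
proof -
  have "(\<forall>k<length (i # w). (f ^^ k) x \<in> (i # w) ! k) \<longleftrightarrow>
      x \<in> i \<and> (\<forall>k<length w. (f ^^ k) (f x) \<in> w ! k)" for x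
    by (auto simp: All_less_Suc2 funpow_swap1)
  then show ?thesis
    using partition_interval(1)[OF assms] maps_unit_interval unfolding word_cell_def by blast
qed

text \<open>
  Openness and convexity are inherited from a word to its extension on the left, because passing
  to the extension means taking the preimage under one continuous strictly monotone branch.
\<close>

lemma word_cell_openin: "w \<in> lists \<I> \<Longrightarrow> openin (top_of_set {0..1}) (word_cell w)"
proof (induction w)
  case (Cons i w)
  then have i: "i \<in> \<I>" and IH: "openin (top_of_set {0..1}) (word_cell w)" by auto
  obtain T where T: "open T" "word_cell w = {0..1} \<inter> T"
    using IH by (auto simp: openin_open)
  have "word_cell (i # w) = i \<inter> f -` T"
    unfolding word_cell_Cons[OF i] T(2)
    using partition_interval(1)[OF i] maps_unit_interval by blast
  moreover have "open (i \<inter> f -` T)"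
    using branch_continuous[OF i] partition_interval(2)[OF i] T(1)
    by (rule continuous_open_preimage)
  ultimately show ?case
    using partition_interval(1)[OF i] by (metis Int_lower1 open_subset order_trans)
qed (simp add: openin_subtopology_self)

lemma word_cell_interval: "w \<in> lists \<I> \<Longrightarrow> is_interval (word_cell w)"
proof (induction w)
  case (Cons i w)
  then have i: "i \<in> \<I>" and IH: "is_interval (word_cell w)" by auto
  have "y \<in> word_cell (i # w)"
    if xz: "x \<in> word_cell (i # w)" "z \<in> word_cell (i # w)" and le: "x \<le> y" "y \<le> z" for x y z
  proof (cases "y = x \<or> y = z")
    case False
    with le have less: "x < y" "y < z" by auto
    have inI: "x \<in> i" "z \<in> i" and im: "f x \<in> word_cell w" "f z \<in> word_cell w"
      using xz unfolding word_cell_Cons[OF i] by auto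
    have y: "y \<in> i"
      using partition_interval(3)[OF i] inI le unfolding is_interval_1 by blast
    have "f x \<le> f y \<and> f y \<le> f z \<or> f z \<le> f y \<and> f y \<le> f x"
      using branch_monotone[OF i] less inI y by (meson strict_mono_onD monotone_onD less_imp_le)
    then have "f y \<in> word_cell w"
      using IH im unfolding is_interval_1 by blast
    with y show ?thesis unfolding word_cell_Cons[OF i] by simp
  qed (use xz in blast)
  then show ?case unfolding is_interval_1 by blast
qed (simp add: is_interval_cc)

lemma shift_space_interval: "s \<in> shift_space \<Longrightarrow> s n \<in> \<I>"
  by (simp add: markov_shift_space_def)

lemma shift_space_covers: "s \<in> shift_space \<Longrightarrow> s (Suc n) \<subseteq> f ` s n"
  by (auto simp: markov_shift_space_def transition_matrix_def split: if_splits)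

lemma left_shift_space: "s \<in> shift_space \<Longrightarrow> left_shift s \<in> shift_space"
  by (simp add: markov_shift_space_def left_shift_def)

lemma prefix_lists: "s \<in> shift_space \<Longrightarrow> map s [0..<n] \<in> lists \<I>"
  using shift_space_interval by auto

lemma cell_Suc:
  assumes "s \<in> shift_space"
  shows "cell s (Suc n) = {x \<in> s 0. f x \<in> cell (left_shift s) n}"
proof -
  have "map s [0..<Suc n] = s 0 # map (left_shift s) [0..<n]"
    by (rule nth_equalityI) (auto simp: left_shift_def nth_Cons split: nat.split simp del: upt_Suc)
  then show ?thesis
    using word_cell_Cons[OF shift_space_interval[OF assms]] by simp
qed

text \<open>
  A point of the cell of the shifted sequence lies in the second interval of the sequence, which is
  covered by the image of the first one.
\<close>

lemma cell_nonempty: "s \<in> shift_space \<Longrightarrow> cell s n \<noteq> {}"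
proof (induction n arbitrary: s)
  case (Suc n)
  show ?case
  proof (cases n)
    case 0
    have i: "s 0 \<in> \<I>" using shift_space_interval[OF Suc.prems] .
    then obtain x where "x \<in> s 0" "x \<in> {0..1}" using partition_interval(1,4)[OF i] by blast
    then have "x \<in> cell s (Suc n)" using 0 by (simp only: cell_iff) simp
    then show ?thesis by blast
  next
    case (Suc m)
    obtain y where y: "y \<in> cell (left_shift s) n"
      using Suc.IH[OF left_shift_space[OF Suc.prems]] by blast
    then have "y \<in> s (Suc 0)" unfolding cell_iff Suc left_shift_def by force
    then obtain x where "x \<in> s 0" "y = f x"
      using shift_space_covers[OF Suc.prems, of 0] by auto
    then show ?thesis using y unfolding cell_Suc[OF Suc.prems] by blast
  qed
qed simp

lemma cell_bounds: "bdd_below (cell s n)" "bdd_above (cell s n)"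
  by (auto intro!: bdd_belowI[of _ 0] bdd_aboveI[of _ 1] simp: cell_iff)

section \<open>Cells shrink to points\<close>

text \<open>
  The left endpoints increase to \<open>a\<close> and the right endpoints decrease to \<open>b\<close>. A gap between
  \<open>a\<close> and \<open>b\<close> would be an open interval all of whose points follow \<open>s\<close>. The limit
  point need not belong to the cells: it may be an endpoint of them.
\<close>

lemma cells_shrink:
  assumes s: "s \<in> shift_space"
  obtains z where "\<And>n. Inf (cell s n) \<le> z" "\<And>n. z \<le> Sup (cell s n)"
    "\<And>e. e > 0 \<Longrightarrow> \<exists>n. cell s n \<subseteq> {z - e<..<z + e}"
proof -
  let ?lo = "\<lambda>n. Inf (cell s n)" and ?hi = "\<lambda>n. Sup (cell s n)"
  define a b where "a = (SUP n. ?lo n)" and "b = (INF n. ?hi n)"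
  note ne = cell_nonempty[OF s]
  have lo_le_hi: "?lo m \<le> ?hi n" for m n
  proof -
    obtain x where "x \<in> cell s (max m n)" using ne by blast
    then have "x \<in> cell s m" "x \<in> cell s n"
      using cell_antimono[of m "max m n" s] cell_antimono[of n "max m n" s] by auto
    then show ?thesis
      using cInf_lower[OF _ cell_bounds(1)] cSup_upper[OF _ cell_bounds(2)] order_trans by blast
  qed
  have bdd: "bdd_above (range ?lo)" "bdd_below (range ?hi)"
    using lo_le_hi by (auto intro!: bdd_aboveI[of _ "?hi 0"] bdd_belowI[of _ "?lo 0"])
  have lo_a: "?lo n \<le> a" for n unfolding a_def by (rule cSUP_upper[OF _ bdd(1)]) simp
  have b_hi: "b \<le> ?hi n" for n unfolding b_def by (rule cINF_lower[OF bdd(2)]) simp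
  have "a \<le> b"
    unfolding a_def b_def by (intro cSUP_least cINF_greatest lo_le_hi) simp_all
  have inside: "x \<in> cell s n" if x: "x \<in> {a<..<b}" for x n
  proof -
    have "?lo n < x" "x < ?hi n" using x lo_a[of n] b_hi[of n] by auto
    then obtain y z where "y \<in> cell s n" "y < x" "z \<in> cell s n" "x < z"
      using cInf_lessD[OF ne] less_cSupD[OF ne] by metis
    then show ?thesis
      using word_cell_interval[OF prefix_lists[OF s]] unfolding is_interval_1 by (meson less_imp_le)
  qed
  have "\<not> a < b"
  proof
    assume "a < b"
    then show False
    proof (rule no_interval_with_constant_itinerary)
      show "{a<..<b} \<subseteq> {0..1}" using inside cell_iff by blast
      show "(f ^^ n) x \<in> s n" if "x \<in> {a<..<b}" for x n
        using inside[OF that, of "Suc n"] unfolding cell_iff by blast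
    qed (rule shift_space_interval[OF s])
  qed
  with \<open>a \<le> b\<close> have "a = b" by simp
  show ?thesis
  proof (rule that[of a])
    show "a \<le> ?hi n" for n using b_hi \<open>a = b\<close> by simp
    fix e :: real assume "e > 0"
    obtain m where m: "a - e < ?lo m"
      using less_cSUP_iff[OF _ bdd(1), of "a - e"] \<open>e > 0\<close> unfolding a_def by auto
    obtain n where n: "?hi n < a + e"
      using cINF_less_iff[OF _ bdd(2), of "a + e"] \<open>e > 0\<close> \<open>a = b\<close> unfolding b_def by auto
    have "x \<in> {a - e<..<a + e}" if x: "x \<in> cell s (max m n)" for x
    proof -
      have "x \<in> cell s m" "x \<in> cell s n"
        using x cell_antimono[of m "max m n" s] cell_antimono[of n "max m n" s] by auto
      then have "?lo m \<le> x" "x \<le> ?hi n"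
        using cInf_lower[OF _ cell_bounds(1)] cSup_upper[OF _ cell_bounds(2)] by blast+
      with m n show ?thesis by simp
    qed
    then show "\<exists>n. cell s n \<subseteq> {a - e<..<a + e}" by blast
  qed (rule lo_a)
qed

lemma cells_shrink_to_member:
  assumes s: "s \<in> shift_space" and x: "\<And>n. x \<in> cell s n" and "e > 0"
  shows "\<exists>n. cell s n \<subseteq> {x - e<..<x + e}"
proof -
  obtain z where z: "\<And>e. e > 0 \<Longrightarrow> \<exists>n. cell s n \<subseteq> {z - e<..<z + e}"
    using cells_shrink[OF s] by metis
  have "\<bar>x - z\<bar> \<le> 0 + d" if d: "d > 0" for d
  proof -
    obtain n where "cell s n \<subseteq> {z - d<..<z + d}" using z[OF d] by blast
    with x[of n] have "x \<in> {z - d<..<z + d}" by blast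
    then show ?thesis by auto
  qed
  then have "\<bar>x - z\<bar> \<le> 0" by (rule field_le_epsilon)
  with z[OF \<open>e > 0\<close>] show ?thesis by simp
qed

lemma cell_member_unique:
  assumes s: "s \<in> shift_space" and x: "\<And>n. x \<in> cell s n" and y: "\<And>n. y \<in> cell s n"
  shows "x = y"
proof (rule ccontr)
  assume "x \<noteq> y"
  then obtain n where "cell s n \<subseteq> {x - \<bar>x - y\<bar><..<x + \<bar>x - y\<bar>}"
    using cells_shrink_to_member[OF s x, of "\<bar>x - y\<bar>"] by auto
  with y[of n] have "y \<in> {x - \<bar>x - y\<bar><..<x + \<bar>x - y\<bar>}" by blast
  then show False by (auto simp: abs_if split: if_splits)
qed

section \<open>Sequences that no point follows\<close>

definition empty_codes :: "(nat \<Rightarrow> real set) set" where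
  "empty_codes = {s \<in> shift_space. \<not> (\<exists>x\<in>{0..1}. \<forall>n. (f ^^ n) x \<in> s n)}"

text \<open>
  The limit \<open>z\<close> of the cells is missing from some cell, and then from all later ones. A later cell
  is an interval that has \<open>z\<close> in its closure, so it lies on one side of \<open>z\<close> and reaches up to it.
\<close>

lemma empty_code_one_sided:
  assumes "s \<in> empty_codes"
  shows "\<exists>z \<in> Inf ` word_cell ` lists \<I> \<union> Sup ` word_cell ` lists \<I>. \<exists>F \<in> {at_right z, at_left z}.
           \<forall>n. \<forall>\<^sub>F x in F. x \<in> cell s n"
proof -
  have s: "s \<in> shift_space" using assms by (simp add: empty_codes_def)
  obtain z where z: "\<And>n. Inf (cell s n) \<le> z" "\<And>n. z \<le> Sup (cell s n)"
    using cells_shrink[OF s] by metis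
  have "\<not> (\<forall>n. z \<in> cell s n)"
    using assms unfolding empty_codes_def cell_iff by blast
  then obtain m where m: "z \<notin> cell s m" by blast
  let ?R = "\<lambda>n. \<forall>\<^sub>F x in at_right z. x \<in> cell s n" and ?L = "\<lambda>n. \<forall>\<^sub>F x in at_left z. x \<in> cell s n"
  have side: "z = Inf (cell s n) \<and> ?R n \<or> z = Sup (cell s n) \<and> ?L n" if "n \<ge> m" for n
  proof (rule interval_one_sided_neighbourhood)
    show "z \<notin> cell s n" using m cell_antimono[OF that] by blast
  qed (use z cell_bounds cell_nonempty[OF s] word_cell_interval[OF prefix_lists[OF s]] in auto)
  have mono: "?R k" if "?R n" "k \<le> n" for k n
    using that(1) by (rule eventually_mono) (use cell_antimono[OF that(2)] in blast)
  have mono': "?L k" if "?L n" "k \<le> n" for k n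
    using that(1) by (rule eventually_mono) (use cell_antimono[OF that(2)] in blast)
  \<comment> \<open>Both properties pass to shorter words, so one failure on the left forces the right everywhere.\<close>
  have "(\<forall>n. ?R n) \<or> (\<forall>n. ?L n)"
  proof (rule disjCI)
    assume "\<not> (\<forall>n. ?L n)"
    then obtain k where k: "\<not> ?L k" by blast
    have "?R n" for n
    proof -
      have "\<not> ?L (max k (max m n))" using k mono' max.cobounded1 by blast
      moreover have "m \<le> max k (max m n)" by simp
      ultimately have "?R (max k (max m n))" using side by blast
      then show ?thesis by (rule mono) simp
    qed
    then show "\<forall>n. ?R n" ..
  qed
  moreover have "z \<in> Inf ` word_cell ` lists \<I> \<union> Sup ` word_cell ` lists \<I>"
    using side[of m] prefix_lists[OF s, of m] by blast
  ultimately show ?thesis by blast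
qed

text \<open>
  In fact there is at most one such sequence: two of them have cells that intersect at every length,
  and intersecting partition intervals are equal.
\<close>

lemma countable_codes_along_filter:
  assumes "F \<noteq> bot"
  shows "countable {s \<in> shift_space. \<forall>n. \<forall>\<^sub>F x in F. x \<in> cell s n}" (is "countable ?S")
proof -
  have "s = t" if st: "s \<in> ?S" "t \<in> ?S" for s t
  proof
    fix k
    have "\<forall>\<^sub>F x in F. x \<in> cell s (Suc k) \<and> x \<in> cell t (Suc k)"
      using st by (simp only: mem_Collect_eq eventually_conj_iff)
    then obtain x where "x \<in> cell s (Suc k)" "x \<in> cell t (Suc k)"
      using eventually_happens'[OF assms] by blast
    then have "(f ^^ k) x \<in> s k" "(f ^^ k) x \<in> t k" unfolding cell_iff by blast+
    then show "s k = t k"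
      using st shift_space_interval by (intro partition_interval_unique) auto
  qed
  then have "inj_on (\<lambda>_. ()) ?S" by (rule inj_onI)
  then show ?thesis by (rule countableI')
qed

lemma countable_empty_codes: "countable empty_codes"
proof -
  let ?E = "Inf ` word_cell ` lists \<I> \<union> Sup ` word_cell ` lists \<I>"
  let ?S = "\<lambda>F. {s \<in> shift_space. \<forall>n. \<forall>\<^sub>F x in F. x \<in> cell s n}"
  have "empty_codes \<subseteq> (\<Union>z\<in>?E. \<Union>F\<in>{at_right z, at_left z}. ?S F)"
  proof
    fix s assume s: "s \<in> empty_codes"
    then have "s \<in> shift_space" by (simp add: empty_codes_def)
    with empty_code_one_sided[OF s] show "s \<in> (\<Union>z\<in>?E. \<Union>F\<in>{at_right z, at_left z}. ?S F)"
      by blast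
  qed
  moreover have "countable (?S F)" if "F \<in> {at_right z, at_left z}" for F and z :: real
    by (rule countable_codes_along_filter)
       (use that trivial_limit_at_right_real[of z] trivial_limit_at_left_real[of z] in
         \<open>metis insertE singletonD\<close>)
  then have "countable (\<Union>z\<in>?E. \<Union>F\<in>{at_right z, at_left z}. ?S F)"
    using countable_intervals
    by (intro countable_UN countable_Un countable_image countable_lists) auto
  ultimately show ?thesis by (rule countable_subset)
qed

section \<open>Points without an itinerary\<close>

definition precritical :: "real set" where
  "precritical = {x \<in> {0..1}. \<exists>n. (f ^^ n) x \<in> C}"

lemma countable_preimage:
  assumes "countable A"
  shows "countable {x \<in> {0..1}. f x \<in> A}"
proof -
  have "countable {x \<in> i. f x \<in> A}" if "i \<in> \<I>" for i
  proof (rule countable_image_inj_on[of f])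
    show "countable (f ` {x \<in> i. f x \<in> A})"
      by (rule countable_subset[OF _ assms]) auto
    show "inj_on f {x \<in> i. f x \<in> A}"
      using branch_inj[OF that] by (rule inj_on_subset) auto
  qed
  then have "countable (C \<union> (\<Union>i\<in>\<I>. {x \<in> i. f x \<in> A}))"
    using countable_points countable_intervals by auto
  then show ?thesis
    by (rule countable_subset[rotated]) (use partition_interval_cover in blast)
qed

lemma countable_precritical: "countable precritical"
proof -
  have "countable {x \<in> {0..1}. (f ^^ n) x \<in> C}" for n
  proof (induction n)
    case 0
    show ?case by (rule countable_subset[OF _ countable_points]) auto
  next
    case (Suc n)
    have "{x \<in> {0..1}. (f ^^ Suc n) x \<in> C} \<subseteq> {x \<in> {0..1}. f x \<in> {x \<in> {0..1}. (f ^^ n) x \<in> C}}"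
      using maps_unit_interval by (auto simp: funpow_swap1)
    then show ?case using countable_preimage[OF Suc.IH] countable_subset by blast
  qed
  then have "countable (\<Union>n. {x \<in> {0..1}. (f ^^ n) x \<in> C})" by simp
  moreover have "precritical = (\<Union>n. {x \<in> {0..1}. (f ^^ n) x \<in> C})"
    unfolding precritical_def by blast
  ultimately show ?thesis by simp
qed

lemma precritical_image_iff:
  assumes "x \<in> {0..1}"
  shows "f x \<in> precritical \<longleftrightarrow> x \<in> precritical"
proof
  assume "f x \<in> precritical"
  then obtain n where "(f ^^ Suc n) x \<in> C" by (auto simp: precritical_def funpow_swap1)
  then show "x \<in> precritical" using assms unfolding precritical_def by blast
next
  assume "x \<in> precritical"
  then obtain n where "(f ^^ n) x \<in> C" by (auto simp: precritical_def)
  then have "(f ^^ n) (f x) \<in> C" using points_invariant by (simp flip: funpow_swap1)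
  then show "f x \<in> precritical" using maps_unit_interval[OF assms] unfolding precritical_def by blast
qed

lemma totally_invariant_precritical: "totally_invariant {0..1} f precritical"
proof -
  have "precritical \<subseteq> {0..1}" by (auto simp: precritical_def)
  then show ?thesis
    unfolding totally_invariant_def using precritical_image_iff by blast
qed

section \<open>The itinerary map\<close>

definition itinerary :: "real \<Rightarrow> nat \<Rightarrow> real set" where
  "itinerary x n = (THE i. i \<in> \<I> \<and> (f ^^ n) x \<in> i)"

lemma itinerary_eqI:
  assumes "\<And>n. s n \<in> \<I>" "\<And>n. (f ^^ n) x \<in> s n"
  shows "itinerary x = s"
proof
  fix n
  show "itinerary x n = s n"
    unfolding itinerary_def
  proof (rule the_equality)
    show "i = s n" if "i \<in> \<I> \<and> (f ^^ n) x \<in> i" for i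
      using partition_interval_unique[of i "s n"] that assms by blast
  qed (use assms in blast)
qed

lemma itinerary:
  assumes "x \<in> {0..1} - precritical"
  shows "itinerary x n \<in> \<I>" "(f ^^ n) x \<in> itinerary x n"
proof -
  have "(f ^^ n) x \<in> {0..1}" "(f ^^ n) x \<notin> C"
    using assms funpow_unit_interval unfolding precritical_def by blast+
  then have "\<exists>!i. i \<in> \<I> \<and> (f ^^ n) x \<in> i"
    using partition_interval_cover partition_interval_unique by blast
  then have "itinerary x n \<in> \<I> \<and> (f ^^ n) x \<in> itinerary x n"
    unfolding itinerary_def by (rule theI')
  then show "itinerary x n \<in> \<I>" "(f ^^ n) x \<in> itinerary x n" by auto
qed

lemma itinerary_cell: "x \<in> {0..1} - precritical \<Longrightarrow> x \<in> cell (itinerary x) n"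
  unfolding cell_iff using itinerary(2) by blast

lemma itinerary_shift_space:
  assumes "x \<in> {0..1} - precritical"
  shows "itinerary x \<in> shift_space"
proof -
  have "transition_matrix f (itinerary x n) (itinerary x (Suc n)) = 1" for n
  proof -
    have "f ((f ^^ n) x) \<in> f ` itinerary x n \<inter> itinerary x (Suc n)"
      using itinerary(2)[OF assms, of n] itinerary(2)[OF assms, of "Suc n"] by simp
    then show ?thesis using transition_iff itinerary(1)[OF assms] by blast
  qed
  with itinerary(1)[OF assms] show ?thesis by (simp add: markov_shift_space_def)
qed

lemma coded_not_precritical:
  assumes "s \<in> shift_space" "x \<in> {0..1}" "\<And>n. (f ^^ n) x \<in> s n"
  shows "x \<in> {0..1} - precritical"
  using assms partition_interval_no_point shift_space_interval unfolding precritical_def by blast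

lemma itinerary_image: "itinerary ` ({0..1} - precritical) = shift_space - empty_codes"
proof (intro equalityI subsetI)
  fix s assume "s \<in> itinerary ` ({0..1} - precritical)"
  then obtain x where x: "x \<in> {0..1} - precritical" "s = itinerary x" by blast
  then show "s \<in> shift_space - empty_codes"
    using itinerary_shift_space itinerary(2)[OF x(1)] unfolding empty_codes_def by blast
next
  fix s assume "s \<in> shift_space - empty_codes"
  then obtain x where s: "s \<in> shift_space" and x: "x \<in> {0..1}" "\<And>n. (f ^^ n) x \<in> s n"
    unfolding empty_codes_def by blast
  have "itinerary x = s" using shift_space_interval[OF s] x(2) by (rule itinerary_eqI)
  then show "s \<in> itinerary ` ({0..1} - precritical)"
    using coded_not_precritical[OF s x] by blast
qed

lemma itinerary_bij: "bij_betw itinerary ({0..1} - precritical) (shift_space - empty_codes)"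
proof -
  have "inj_on itinerary ({0..1} - precritical)"
  proof (rule inj_onI)
    fix x y assume "x \<in> {0..1} - precritical" "y \<in> {0..1} - precritical" "itinerary x = itinerary y"
    then show "x = y"
      using cell_member_unique[OF itinerary_shift_space] itinerary_cell by metis
  qed
  then show ?thesis using itinerary_image by (simp add: bij_betw_def)
qed

lemma itinerary_image_f:
  assumes "x \<in> {0..1} - precritical"
  shows "itinerary (f x) = left_shift (itinerary x)"
proof (rule itinerary_eqI)
  show "left_shift (itinerary x) n \<in> \<I>" for n
    using itinerary(1)[OF assms] by (simp add: left_shift_def)
  show "(f ^^ n) (f x) \<in> left_shift (itinerary x) n" for n
    using itinerary(2)[OF assms, of "Suc n"] by (simp add: left_shift_def funpow_swap1)
qed

text \<open>
  A point following a sequence is mapped to a point following the shifted sequence. Conversely, a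
  point following the shifted sequence has a preimage in the first partition interval, since the
  image of that interval covers the second one.
\<close>

lemma totally_invariant_empty_codes: "totally_invariant shift_space left_shift empty_codes"
proof -
  have "left_shift s \<in> empty_codes \<longleftrightarrow> s \<in> empty_codes" if s: "s \<in> shift_space" for s
  proof -
    have "(\<exists>x\<in>{0..1}. \<forall>n. (f ^^ n) x \<in> s n) \<longleftrightarrow> (\<exists>y\<in>{0..1}. \<forall>n. (f ^^ n) y \<in> left_shift s n)"
    proof
      assume "\<exists>x\<in>{0..1}. \<forall>n. (f ^^ n) x \<in> s n"
      then obtain x where x: "x \<in> {0..1}" "\<And>n. (f ^^ n) x \<in> s n" by blast
      have "(f ^^ n) (f x) \<in> left_shift s n" for n
        using x(2)[of "Suc n"] by (simp add: left_shift_def funpow_swap1)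
      then show "\<exists>y\<in>{0..1}. \<forall>n. (f ^^ n) y \<in> left_shift s n"
        using maps_unit_interval[OF x(1)] by blast
    next
      assume "\<exists>y\<in>{0..1}. \<forall>n. (f ^^ n) y \<in> left_shift s n"
      then obtain y where y: "\<And>n. (f ^^ n) y \<in> left_shift s n" by blast
      have "y \<in> s (Suc 0)" using y[of 0] by (simp add: left_shift_def)
      then obtain x where x: "x \<in> s 0" "y = f x"
        using shift_space_covers[OF s, of 0] by blast
      have "(f ^^ n) x \<in> s n" for n
        using x y by (cases n) (auto simp: left_shift_def funpow_swap1)
      moreover have "x \<in> {0..1}" using partition_interval(1)[OF shift_space_interval[OF s]] x by blast
      ultimately show "\<exists>x\<in>{0..1}. \<forall>n. (f ^^ n) x \<in> s n" by blast
    qed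
    then show ?thesis using s left_shift_space[OF s] unfolding empty_codes_def by blast
  qed
  moreover have "empty_codes \<subseteq> shift_space" by (auto simp: empty_codes_def)
  ultimately show ?thesis unfolding totally_invariant_def by blast
qed

section \<open>Measurability and the isomorphism\<close>

abbreviation "unit_borel \<equiv> restrict_space (borel_of (top_of_set {0..1::real})) ({0..1} - precritical)"
abbreviation "shift_borel \<equiv>
  restrict_space (borel_of (markov_shift \<I> (transition_matrix f))) (shift_space - empty_codes)"

lemma itinerary_measurable: "itinerary \<in> unit_borel \<rightarrow>\<^sub>M shift_borel"
proof (rule measurable_of_countable_neighbourhoods)
  show "countable (lists \<I>)" using countable_intervals by (rule countable_lists)
  show "openin (top_of_set {0..1}) (word_cell w)" if "w \<in> lists \<I>" for w
    using that by (rule word_cell_openin)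
  show "itinerary \<in> {0..1} - precritical \<rightarrow> shift_space - empty_codes"
    using itinerary_image by blast
  fix U x assume U: "openin (markov_shift \<I> (transition_matrix f)) U"
    and x: "x \<in> {0..1} - precritical" "itinerary x \<in> U"
  obtain n where n: "cylinder \<I> (transition_matrix f) (map (itinerary x) [0..<n]) \<subseteq> U"
    using openin_markov_shift_cylinder[OF U x(2)] by blast
  have "itinerary y \<in> U" if y: "y \<in> cell (itinerary x) n" "y \<in> {0..1} - precritical" for y
  proof -
    have "itinerary y k = itinerary x k" if "k < n" for k
      using y(1) that itinerary[OF y(2)] itinerary(1)[OF x(1)] partition_interval_unique
      unfolding cell_iff by blast
    then have "itinerary y \<in> cylinder \<I> (transition_matrix f) (map (itinerary x) [0..<n])"
      using itinerary_shift_space[OF y(2)] by (auto simp: cylinder_def)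
    with n show ?thesis by blast
  qed
  then show "\<exists>w\<in>lists \<I>. x \<in> word_cell w \<and> itinerary ` (word_cell w \<inter> ({0..1} - precritical)) \<subseteq> U"
    using itinerary_cell[OF x(1), of n] prefix_lists[OF itinerary_shift_space[OF x(1)], of n] by blast
qed simp_all

definition coded_point :: "(nat \<Rightarrow> real set) \<Rightarrow> real" where
  "coded_point = inv_into ({0..1} - precritical) itinerary"

lemma coded_point:
  assumes "s \<in> shift_space - empty_codes"
  shows "coded_point s \<in> {0..1} - precritical" "itinerary (coded_point s) = s"
  using assms inv_into_into[of s itinerary "{0..1} - precritical"]
    f_inv_into_f[of s itinerary "{0..1} - precritical"]
  unfolding coded_point_def itinerary_image by blast+

lemma coded_point_measurable: "coded_point \<in> shift_borel \<rightarrow>\<^sub>M unit_borel"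
proof (rule measurable_of_countable_neighbourhoods)
  let ?cyl = "cylinder \<I> (transition_matrix f)"
  show "countable (lists \<I>)" using countable_intervals by (rule countable_lists)
  show "openin (markov_shift \<I> (transition_matrix f)) (?cyl w)" if "w \<in> lists \<I>" for w
    using that unfolding markov_shift_def by (intro topology_generated_by_Basis) blast
  show "coded_point \<in> shift_space - empty_codes \<rightarrow> {0..1} - precritical"
    using coded_point(1) by blast
  fix U s assume U: "openin (top_of_set {0..1}) U"
    and s: "s \<in> shift_space - empty_codes" and sU: "coded_point s \<in> U"
  have s': "s \<in> shift_space" using s by blast
  obtain e where e: "e > 0" "{coded_point s - e<..<coded_point s + e} \<inter> {0..1} \<subseteq> U"
  proof -
    obtain e where "e > 0" "ball (coded_point s) e \<inter> {0..1} \<subseteq> U"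
      using bspec[OF conjunct2[OF U[unfolded openin_contains_ball]] sU] by blast
    then show ?thesis by (intro that) (simp_all add: ball_eq_greaterThanLessThan)
  qed
  have "coded_point s \<in> cell s n" for n
    using itinerary_cell[OF coded_point(1)[OF s], of n] coded_point(2)[OF s] by simp
  then obtain n where n: "cell s n \<subseteq> {coded_point s - e<..<coded_point s + e}"
    using cells_shrink_to_member[OF s' _ e(1)] by blast
  have "coded_point t \<in> U" if t: "t \<in> ?cyl (map s [0..<n])" "t \<in> shift_space - empty_codes" for t
  proof -
    have "map t [0..<n] = map s [0..<n]" using t(1) by (auto simp: cylinder_def)
    then have "coded_point t \<in> cell s n"
      using itinerary_cell[OF coded_point(1)[OF t(2)], of n] by (simp only: coded_point(2)[OF t(2)])
    with n e(2) show ?thesis using coded_point(1)[OF t(2)] by blast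
  qed
  moreover have "s \<in> ?cyl (map s [0..<n])" using s' by (simp add: cylinder_def)
  ultimately show "\<exists>w\<in>lists \<I>. s \<in> ?cyl w \<and> coded_point ` (?cyl w \<inter> (shift_space - empty_codes)) \<subseteq> U"
    using prefix_lists[OF s', of n] by blast
qed auto

lemma isomorphic_mod_countable_markov_shift:
  "isomorphic_mod_countable (markov_shift \<I> (transition_matrix f)) left_shift (top_of_set {0..1}) f"
proof -
  have inverse: "inv_into (shift_space - empty_codes) coded_point x = itinerary x"
    if "x \<in> {0..1} - precritical" for x
    unfolding coded_point_def using itinerary_bij that by (rule inv_into_inv_into_eq)
  have "space unit_borel \<subseteq> {0..1} - precritical"
    by (simp add: space_restrict_space)
  then have "inv_into (shift_space - empty_codes) coded_point \<in> unit_borel \<rightarrow>\<^sub>M shift_borel"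
    using itinerary_measurable inverse by (subst measurable_cong[where g = itinerary]) auto
  moreover have "f (coded_point s) = coded_point (left_shift s)"
    if s: "s \<in> shift_space - empty_codes" for s
  proof -
    note x = coded_point[OF s]
    have "f (coded_point s) \<in> {0..1} - precritical"
      using x(1) maps_unit_interval precritical_image_iff by blast
    then have "f (coded_point s) = coded_point (itinerary (f (coded_point s)))"
      unfolding coded_point_def using bij_betw_inv_into_left[OF itinerary_bij] by simp
    also have "itinerary (f (coded_point s)) = left_shift s"
      using itinerary_image_f[OF x(1)] x(2) by simp
    finally show ?thesis .
  qed
  moreover have "bij_betw coded_point (shift_space - empty_codes) ({0..1} - precritical)"
    unfolding coded_point_def using itinerary_bij by (rule bij_betw_inv_into)
  ultimately show ?thesis
    unfolding isomorphic_mod_countable_def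
    using countable_empty_codes totally_invariant_empty_codes
      countable_precritical totally_invariant_precritical coded_point_measurable
    by (intro exI[of _ empty_codes] exI[of _ precritical] exI[of _ coded_point]) simp
qed

end

theorem theorem6p2:
  fixes f :: "real \<Rightarrow> real" and \<X> :: "real set set"
    and M :: "real set \<Rightarrow> real set \<Rightarrow> nat"
  assumes "countably_markov_mixing f \<X>"
    and "M = transition_matrix f"
  shows "isomorphic_mod_countable
           (markov_shift (partition_intervals \<X>) M) left_shift
           (top_of_set {0..1}) f"
proof -
  interpret countably_markov_mixing_map f \<X>
    using assms(1) by unfold_locales
  show ?thesis
    unfolding assms(2) by (rule isomorphic_mod_countable_markov_shift)
qed

end
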